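(* Let $S\subseteq\mathbb{N}^d$ be a $\mathcal{C}$-semigroup such that $\mathrm{cone}(S)\cap\mathbb{N}^d=\mathbb{N}^d$, let $\prec$ be a term order on $\mathbb{N}^d$, and let $F(S)_\prec$ be the Frobenius element of $S$ with respect to $\prec$. Then: (1) $S$ is $\prec$-symmetric if and only if $|\mathcal{H}(S)|=|\{g\in S\mid g\le_c F(S)_\prec\}|$. (2) $S$ is $\prec$-pseudo-symmetric if and only if $|\mathcal{H}(S)\setminus\{F(S)_\prec/2\}|=|\{g\in S\mid g\le_c F(S)_\prec\}|$ and $F(S)_\prec$ is even.
   Context: $\mathbb{N}$ denotes the non-negative integers. An affine semigroup $S$ is a finitely generated submonoid of $\mathbb{N}^d$, with minimal generating set $\{a_1,\dots,a_n\}$. Put $\mathrm{cone}(S)=\{\sum_{i=1}^n\lambda_i a_i\mid \lambda_i\in\mathbb{Q}_{\ge 0}\}$ and $\mathcal{H}(S)=(\mathrm{cone}(S)\setminus S)\cap\mathbb{N}^d$. The set of pseudo-Frobenius elements is $\mathrm{PF}(S)=\{f\in\mathcal{H}(S)\mid f+s\in S \text{ for all } s\in S\setminus\{0\}\}$. $S$ is an MPD-semigroup if $\mathrm{PF}(S)\neq\emptyset$. $S$ is a $\mathcal{C}$-semigroup if it is an MPD-semigroup and $\mathcal{H}(S)$ is non-empty and finite. The relation $\le_c$ is the componentwise order: $g\le_c f$ if $g_i\le f_i$ for all $i\in[1,d]$. A term order (monomial ordering) on $\mathbb{N}^d$ is a total order $\prec$ compatible with addition and with $0\prec a$ for all $a\neq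 0$. The Frobenius element with respect to $\prec$ is $F(S)_\prec=\max_\prec\mathcal{H}(S)$ (if it exists; it does when $\mathcal{H}(S)$ is finite and non-empty). "$F(S)_\prec$ is even" means all its coordinates are even. $S$ is $\prec$-symmetric if $F(S)_\prec$ exists and $\mathrm{PF}(S)=\{F(S)_\prec\}$. Put $\mathrm{PF}'_\prec(S)=\mathrm{PF}(S)\setminus\{F(S)_\prec\}$. $S$ is $\prec$-almost symmetric if $F(S)_\prec$ exists, $\mathrm{PF}'_\prec(S)\neq\emptyset$, and $F(S)_\prec-g\in\mathrm{PF}'_\prec(S)$ for every $g\in\mathrm{PF}'_\prec(S)$. $S$ is $\prec$-pseudo-symmetric if it is $\prec$-almost symmetric and $|\mathrm{PF}(S)|=2$; in this case $\mathrm{PF}(S)=\{F(S)_\prec,F(S)_\prec/2\}$. *)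

theory Defs
  imports "HOL-Analysis.Analysis"
begin

text \<open>
  The monoid \<open>\<nat>\<^sup>d\<close> is the type \<^typ>\<open>nat ^ 'd\<close> with \<open>d = CARD('d)\<close>. Its library order
  \<open>\<le>\<close> is the componentwise order. Cones, differences and halves are taken in
  \<^typ>\<open>rat ^ 'd\<close>, because subtraction and division on \<^typ>\<open>nat\<close> truncate.
\<close>

definition rat_vec :: "nat ^ 'd \<Rightarrow> rat ^ 'd" where
  "rat_vec x = (\<chi> i. of_nat (x $ i))"

definition submonoid :: "'a::comm_monoid_add set \<Rightarrow> bool" where
  "submonoid S \<longleftrightarrow> 0 \<in> S \<and> (\<forall>x\<in>S. \<forall>y\<in>S. x + y \<in> S)"

definition affine_semigroup :: "(nat ^ 'd) set \<Rightarrow> bool" where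
  "affine_semigroup S \<longleftrightarrow> (\<exists>A. finite A \<and> submonoid hull A = S)"

definition minimal_generating_set :: "(nat ^ 'd) set \<Rightarrow> (nat ^ 'd) set \<Rightarrow> bool" where
  "minimal_generating_set A S \<longleftrightarrow>
     submonoid hull A = S \<and> (\<forall>B. B \<subset> A \<longrightarrow> submonoid hull B \<noteq> S)"

definition minimal_generators :: "(nat ^ 'd) set \<Rightarrow> (nat ^ 'd) set" where
  "minimal_generators S = (THE A. minimal_generating_set A S)"

definition rat_cone :: "(nat ^ 'd) set \<Rightarrow> (rat ^ 'd) set" where
  "rat_cone S = {\<Sum>a\<in>minimal_generators S. l a *s rat_vec a | l. \<forall>a\<in>minimal_generators S. 0 \<le> l a}"

definition gaps :: "(nat ^ 'd) set \<Rightarrow> (nat ^ 'd) set" where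
  "gaps S = {x. rat_vec x \<in> rat_cone S \<and> x \<notin> S}"

definition pseudo_frobenius :: "(nat ^ 'd) set \<Rightarrow> (nat ^ 'd) set" where
  "pseudo_frobenius S = {f \<in> gaps S. \<forall>s\<in>S - {0}. f + s \<in> S}"

definition MPD_semigroup :: "(nat ^ 'd) set \<Rightarrow> bool" where
  "MPD_semigroup S \<longleftrightarrow> affine_semigroup S \<and> pseudo_frobenius S \<noteq> {}"

definition C_semigroup :: "(nat ^ 'd) set \<Rightarrow> bool" where
  "C_semigroup S \<longleftrightarrow> MPD_semigroup S \<and> gaps S \<noteq> {} \<and> finite (gaps S)"

text \<open>Term orders are given by their strict part.\<close>

definition term_order :: "(nat ^ 'd \<Rightarrow> nat ^ 'd \<Rightarrow> bool) \<Rightarrow> bool" where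
  "term_order prec \<longleftrightarrow>
     irreflp prec \<and> transp prec \<and> totalp prec \<and>
     (\<forall>a b c. prec a b \<longrightarrow> prec (a + c) (b + c)) \<and>
     (\<forall>a. a \<noteq> 0 \<longrightarrow> prec 0 a)"

definition is_frobenius ::
    "(nat ^ 'd \<Rightarrow> nat ^ 'd \<Rightarrow> bool) \<Rightarrow> (nat ^ 'd) set \<Rightarrow> nat ^ 'd \<Rightarrow> bool" where
  "is_frobenius prec S f \<longleftrightarrow> f \<in> gaps S \<and> (\<forall>h\<in>gaps S. h \<noteq> f \<longrightarrow> prec h f)"

text \<open>The value \<open>frobenius prec S\<close> is meaningful only if some \<open>f\<close> satisfies
  \<open>is_frobenius prec S f\<close>.\<close>

definition frobenius ::
    "(nat ^ 'd \<Rightarrow> nat ^ 'd \<Rightarrow> bool) \<Rightarrow> (nat ^ 'd) set \<Rightarrow> nat ^ 'd" where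
  "frobenius prec S = (THE f. is_frobenius prec S f)"

definition even_vec :: "nat ^ 'd \<Rightarrow> bool" where
  "even_vec f \<longleftrightarrow> (\<forall>i. even (f $ i))"

definition prec_symmetric ::
    "(nat ^ 'd \<Rightarrow> nat ^ 'd \<Rightarrow> bool) \<Rightarrow> (nat ^ 'd) set \<Rightarrow> bool" where
  "prec_symmetric prec S \<longleftrightarrow>
     (\<exists>f. is_frobenius prec S f) \<and> pseudo_frobenius S = {frobenius prec S}"

definition pseudo_frobenius' ::
    "(nat ^ 'd \<Rightarrow> nat ^ 'd \<Rightarrow> bool) \<Rightarrow> (nat ^ 'd) set \<Rightarrow> (nat ^ 'd) set" where
  "pseudo_frobenius' prec S = pseudo_frobenius S - {frobenius prec S}"

definition prec_almost_symmetric ::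
    "(nat ^ 'd \<Rightarrow> nat ^ 'd \<Rightarrow> bool) \<Rightarrow> (nat ^ 'd) set \<Rightarrow> bool" where
  "prec_almost_symmetric prec S \<longleftrightarrow>
     (\<exists>f. is_frobenius prec S f) \<and>
     pseudo_frobenius' prec S \<noteq> {} \<and>
     (\<forall>g\<in>pseudo_frobenius' prec S.
        rat_vec (frobenius prec S) - rat_vec g \<in> rat_vec ` pseudo_frobenius' prec S)"

definition prec_pseudo_symmetric ::
    "(nat ^ 'd \<Rightarrow> nat ^ 'd \<Rightarrow> bool) \<Rightarrow> (nat ^ 'd) set \<Rightarrow> bool" where
  "prec_pseudo_symmetric prec S \<longleftrightarrow>
     prec_almost_symmetric prec S \<and> card (pseudo_frobenius S) = 2"

text \<open>The minimal generating set exists and is unique, so the definite description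
  in \<open>minimal_generators\<close> is justified: it consists of the nonzero elements that are
  not sums of two nonzero elements.\<close>

definition indecomposables :: "(nat ^ 'd) set \<Rightarrow> (nat ^ 'd) set" where
  "indecomposables S =
     {a \<in> S. a \<noteq> 0 \<and> (\<forall>x\<in>S. \<forall>y\<in>S. a = x + y \<longrightarrow> x = 0 \<or> y = 0)}"

lemma submonoid_hull: "submonoid (submonoid hull A)"
  by (rule hull_in) (auto simp: submonoid_def)

lemma indecomposables_subset:
  assumes "submonoid hull A = S"
  shows "indecomposables S \<subseteq> A"
proof
  fix a assume a: "a \<in> indecomposables S"
  have S: "submonoid S" using submonoid_hull[of A] assms by simp
  show "a \<in> A"
  proof (rule ccontr)
    assume "a \<notin> A"
    then have "A \<subseteq> S - {a}" using hull_subset[of A submonoid] assms by auto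
    moreover have "submonoid (S - {a})"
      unfolding submonoid_def
    proof (intro conjI ballI)
      show "0 \<in> S - {a}" using S a by (auto simp: submonoid_def indecomposables_def)
      fix x y assume xy: "x \<in> S - {a}" "y \<in> S - {a}"
      have "x + y \<noteq> a"
      proof
        assume eq: "x + y = a"
        with a xy have "x = 0 \<or> y = 0" unfolding indecomposables_def by blast
        with eq xy show False by auto
      qed
      then show "x + y \<in> S - {a}" using S xy by (simp add: submonoid_def)
    qed
    ultimately have "S \<subseteq> S - {a}" using hull_minimal[of A "S - {a}" submonoid] assms by simp
    with a show False by (auto simp: indecomposables_def)
  qed
qed

lemma indecomposables_generate:
  fixes S :: "(nat ^ 'd) set"
  assumes S: "submonoid S"
  shows "submonoid hull (indecomposables S) = S"
proof
  show "submonoid hull (indecomposables S) \<subseteq> S"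
    by (rule hull_minimal) (auto simp: S indecomposables_def)
  let ?H = "submonoid hull (indecomposables S)"
  let ?m = "\<lambda>a :: nat ^ 'd. \<Sum>i\<in>UNIV. a $ i"
  have pos: "?m a > 0" if "a \<noteq> 0" for a
  proof -
    from that obtain i where "a $ i \<noteq> 0" by (auto simp: vec_eq_iff)
    then show ?thesis by (intro sum_pos2[of UNIV i]) simp_all
  qed
  have "a \<in> S \<longrightarrow> a \<in> ?H" for a
  proof (induction "?m a" arbitrary: a rule: less_induct)
    case less
    show ?case
    proof
      assume aS: "a \<in> S"
      consider "a = 0" | "a \<in> indecomposables S"
        | x y where "x \<in> S" "y \<in> S" "x \<noteq> 0" "y \<noteq> 0" "a = x + y"
        using aS unfolding indecomposables_def by blast
      then show "a \<in> ?H"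
      proof cases
        case 1 then show ?thesis using submonoid_hull by (auto simp: submonoid_def)
      next
        case 2 then show ?thesis by (rule hull_inc)
      next
        case 3
        have "?m a = ?m x + ?m y" unfolding 3(5) by (simp add: sum.distrib)
        then have "?m x < ?m a" "?m y < ?m a" using pos[of x] pos[of y] 3(3,4) by linarith+
        then have "x \<in> ?H" "y \<in> ?H" using less[of x] less[of y] 3(1,2) by simp_all
        then show ?thesis
          using submonoid_hull[of "indecomposables S"] 3(5) unfolding submonoid_def by blast
      qed
    qed
  qed
  then show "S \<subseteq> ?H" by blast
qed

lemma minimal_generating_set_iff:
  assumes "submonoid S"
  shows "minimal_generating_set A S \<longleftrightarrow> A = indecomposables S"
proof
  assume A: "minimal_generating_set A S"
  then have "indecomposables S \<subseteq> A"
    by (intro indecomposables_subset) (simp add: minimal_generating_set_def)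
  moreover have "\<not> indecomposables S \<subset> A"
    using A indecomposables_generate[OF assms] unfolding minimal_generating_set_def by metis
  ultimately show "A = indecomposables S" by blast
next
  assume A: "A = indecomposables S"
  have "submonoid hull B \<noteq> S" if "B \<subset> A" for B
    using indecomposables_subset[of B S] A that by blast
  then show "minimal_generating_set A S"
    using A indecomposables_generate[OF assms] by (simp add: minimal_generating_set_def)
qed

lemma minimal_generators_eq: "submonoid S \<Longrightarrow> minimal_generators S = indecomposables S"
  by (simp add: minimal_generators_def minimal_generating_set_iff)

end

theory Submission
  imports Defs
begin

text \<open>
  Since the cone contains all of \<open>\<nat>\<^sup>d\<close>, the gaps are the complement of \<open>S\<close>. The map
  \<open>g \<mapsto> F - g\<close> injects the elements of \<open>S\<close> below \<open>F\<close> into the gaps, as \<open>F \<notin> S\<close>, and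
  never hits \<open>F/2\<close>. So both cardinality conditions say that every gap \<open>h\<close> (other than \<open>F/2\<close>)
  satisfies \<open>F \<in> h + S\<close>. They are compared with the pseudo-Frobenius elements by means of the
  fact that each gap \<open>h\<close> has a pseudo-Frobenius element in \<open>h + S\<close>, namely a maximal gap there.
\<close>

section \<open>Componentwise order, rational embedding and halves\<close>

lemma le_iff_add_vec:
  fixes x y :: "nat ^ 'd"
  shows "x \<le> y \<longleftrightarrow> (\<exists>z. y = x + z)"
proof
  assume "x \<le> y"
  then have "y = x + (y - x)" by (simp add: vec_eq_iff less_eq_vec_def)
  then show "\<exists>z. y = x + z" ..
qed (auto simp: less_eq_vec_def)

lemma rat_vec_inject: "rat_vec x = rat_vec y \<longleftrightarrow> x = y"
  by (simp add: rat_vec_def vec_eq_iff)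

lemma rat_vec_add: "rat_vec (x + y) = rat_vec x + rat_vec y"
  by (simp add: rat_vec_def vec_eq_iff)

text \<open>Clearing the denominator coordinatewise turns the rational vector \<open>F/2\<close>
  into an additive equation over the naturals, the form in which halves are handled below.\<close>

lemma rat_vec_eq_half_iff: "rat_vec h = (1 / 2) *s rat_vec f \<longleftrightarrow> f = h + h"
proof -
  have "of_nat a = (of_nat b / 2 :: rat) \<longleftrightarrow> b = a + a" for a b
  proof -
    have "of_nat a = (of_nat b / 2 :: rat) \<longleftrightarrow> of_nat b = (of_nat (a + a) :: rat)"
      by (auto simp: field_simps)
    then show ?thesis by (simp only: of_nat_eq_iff)
  qed
  then show ?thesis by (simp add: rat_vec_def vec_eq_iff)
qed

lemma even_vec_iff: "even_vec f \<longleftrightarrow> (\<exists>g. f = g + g)"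
proof
  assume "even_vec f"
  then have "f = (\<chi> i. f $ i div 2) + (\<chi> i. f $ i div 2)"
    by (simp add: even_vec_def vec_eq_iff flip: mult_2)
  then show "\<exists>g. f = g + g" ..
qed (auto simp: even_vec_def)

section \<open>Gaps and the Frobenius element\<close>

lemma affine_semigroup_submonoid: "affine_semigroup S \<Longrightarrow> submonoid S"
  using submonoid_hull by (auto simp: affine_semigroup_def)

lemma gaps_eq_Compl:
  assumes "rat_cone S \<inter> range rat_vec = range rat_vec"
  shows "gaps S = - S"
  using assms by (auto simp: gaps_def)

lemma ex_is_frobenius:
  assumes "term_order prec" "finite (gaps S)" "gaps S \<noteq> {}"
  shows "\<exists>f. is_frobenius prec S f"
proof -
  have "irreflp prec" "transp prec" "totalp prec"
    using assms(1) by (auto simp: term_order_def)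
  then have "asymp_on (gaps S) prec"
    by (intro asymp_onI) (metis irreflpD transpD)
  moreover have "transp_on (gaps S) prec" "totalp_on (gaps S) prec"
    using \<open>transp prec\<close> \<open>totalp prec\<close> by (auto intro: transp_on_subset totalp_on_subset)
  ultimately show ?thesis
    using Finite_Set.bex_greatest_element[of "gaps S" prec] assms(2,3)
    unfolding is_frobenius_def by blast
qed

lemma is_frobenius_frobenius:
  assumes "term_order prec" "is_frobenius prec S f"
  shows "is_frobenius prec S (frobenius prec S)"
  unfolding frobenius_def
proof (rule theI)
  show "is_frobenius prec S f" by fact
  fix g assume "is_frobenius prec S g"
  then show "g = f"
    using assms unfolding is_frobenius_def term_order_def by (metis irreflpD transpD)
qed

text \<open>Adding a nonzero \<open>s\<close> strictly increases an element in a term order, so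
  \<open>f + s\<close> lies beyond the largest gap and must be in \<open>S\<close>.\<close>

lemma is_frobenius_pseudo_frobenius:
  assumes "term_order prec" "gaps S = - S" "is_frobenius prec S f"
  shows "f \<in> pseudo_frobenius S"
proof -
  have "f + s \<in> S" if "s \<noteq> 0" for s
  proof (rule ccontr)
    assume "f + s \<notin> S"
    then have "prec (f + s) f"
      using assms(2,3) that by (auto simp: is_frobenius_def)
    moreover have "prec (0 + f) (s + f)"
      using assms(1) that unfolding term_order_def by blast
    ultimately show False
      using assms(1) by (metis add.commute add.left_neutral irreflpD term_order_def transpD)
  qed
  then show ?thesis
    using assms(3) by (simp add: pseudo_frobenius_def is_frobenius_def)
qed

section \<open>Pseudo-Frobenius elements above a gap, and counting by reflection\<close>

lemma gap_add_pseudo_frobenius: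
  assumes "submonoid S" "gaps S = - S" "finite (gaps S)" "h \<in> gaps S"
  obtains s where "s \<in> S" "h + s \<in> pseudo_frobenius S"
proof -
  let ?A = "{h + s | s. s \<in> S} \<inter> gaps S"
  have "h + 0 \<in> ?A" using assms(1,4) by (auto simp: submonoid_def intro!: exI[of _ 0])
  \<comment> \<open>Maximality is for the componentwise order, on a finite set that contains
    \<open>h\<close> itself. Adding an element of \<open>S\<close> to \<open>m\<close> stays inside
    \<open>h + S\<close>, so it can only leave the gaps.\<close>
  then obtain m where m: "m \<in> ?A" "\<forall>b\<in>?A. m \<le> b \<longrightarrow> m = b"
    using finite_has_maximal[of ?A] assms(3) by blast
  then obtain s where s: "s \<in> S" "m = h + s" by blast
  have "m + t \<in> S" if t: "t \<in> S" "t \<noteq> 0" for t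
  proof (rule ccontr)
    assume "m + t \<notin> S"
    moreover have "s + t \<in> S" using assms(1) s(1) t(1) by (simp add: submonoid_def)
    ultimately have "m + t \<in> ?A" using assms(2) s(2) by (auto simp: add.assoc)
    moreover have "m \<le> m + t" using le_iff_add_vec by blast
    ultimately have "m = m + t" using m(2) by blast
    then show False using t(2) by simp
  qed
  then have "m \<in> pseudo_frobenius S" using m(1) by (simp add: pseudo_frobenius_def)
  then show ?thesis using that s by blast
qed

text \<open>A nonzero \<open>s\<close> would bring \<open>f + s\<close> into \<open>S\<close>, so
  \<open>s = 0\<close>. It is applied with \<open>f + s = F\<close>, to conclude
  \<open>f = F\<close>.\<close>

lemma pseudo_frobenius_eqI:
  assumes "f \<in> pseudo_frobenius S" "s \<in> S" "f + s \<notin> S"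
  shows "f = f + s"
  using assms by (cases "s = 0") (auto simp: pseudo_frobenius_def)

text \<open>Reflection in \<open>F\<close> embeds the elements of \<open>S\<close> below
  \<open>F\<close> into the finite set \<open>H\<close>, so equal cardinality means surjectivity.
  \<open>H\<close> is kept general to cover both all gaps and the gaps without
  \<open>F/2\<close>.\<close>

lemma card_complement_eq_iff:
  fixes S H :: "(nat ^ 'd) set"
  assumes "finite H" and "\<And>g h. g \<in> S \<Longrightarrow> F = h + g \<Longrightarrow> h \<in> H"
  shows "card H = card {g \<in> S. g \<le> F} \<longleftrightarrow> (\<forall>h\<in>H. \<exists>s\<in>S. F = h + s)"
proof -
  let ?L = "{g \<in> S. g \<le> F}"
  \<comment> \<open>Subtraction truncates in each coordinate; \<open>g \<le> F\<close> makes it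
    genuine.\<close>
  have sum: "F = (F - g) + g" if "g \<in> ?L" for g
    using that by (auto simp: le_iff_add_vec add.commute)
  have inj: "inj_on (\<lambda>g. F - g) ?L"
  proof (rule inj_onI)
    fix x y assume "x \<in> ?L" "y \<in> ?L" "F - x = F - y"
    then have "(F - y) + x = (F - y) + y" using sum by metis
    then show "x = y" by simp
  qed
  have sub: "(\<lambda>g. F - g) ` ?L \<subseteq> H" using sum assms(2) by blast
  have "card H = card ?L \<longleftrightarrow> (\<lambda>g. F - g) ` ?L = H"
    using card_subset_eq[OF assms(1) sub] card_image[OF inj] by auto
  also have "\<dots> \<longleftrightarrow> (\<forall>h\<in>H. \<exists>s\<in>S. F = h + s)"
  proof
    assume "(\<lambda>g. F - g) ` ?L = H"
    then show "\<forall>h\<in>H. \<exists>s\<in>S. F = h + s" using sum by blast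
  next
    assume *: "\<forall>h\<in>H. \<exists>s\<in>S. F = h + s"
    have "h \<in> (\<lambda>g. F - g) ` ?L" if h: "h \<in> H" for h
    proof -
      obtain s where s: "s \<in> S" "F = h + s" using * h by blast
      moreover have "s \<le> F" using s(2) le_iff_add_vec[of s F] add.commute[of h s] by blast
      moreover have "h = F - s" using s(2) by simp
      ultimately show ?thesis by blast
    qed
    then show "(\<lambda>g. F - g) ` ?L = H" using sub by blast
  qed
  finally show ?thesis .
qed

section \<open>One or two pseudo-Frobenius elements\<close>

lemma pseudo_frobenius_singleton_iff:
  assumes "submonoid S" "gaps S = - S" "finite (gaps S)" "F \<in> pseudo_frobenius S"
  shows "pseudo_frobenius S = {F} \<longleftrightarrow> (\<forall>h\<in>gaps S. \<exists>s\<in>S. F = h + s)"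
proof
  assume PF: "pseudo_frobenius S = {F}"
  show "\<forall>h\<in>gaps S. \<exists>s\<in>S. F = h + s"
  proof
    fix h assume "h \<in> gaps S"
    with assms obtain s where "s \<in> S" "h + s \<in> pseudo_frobenius S"
      by (metis gap_add_pseudo_frobenius)
    then show "\<exists>s\<in>S. F = h + s" using PF by auto
  qed
next
  assume *: "\<forall>h\<in>gaps S. \<exists>s\<in>S. F = h + s"
  have "f = F" if f: "f \<in> pseudo_frobenius S" for f
  proof -
    obtain s where "s \<in> S" "F = f + s" using * f by (auto simp: pseudo_frobenius_def)
    moreover have "F \<notin> S" using assms(2,4) by (auto simp: pseudo_frobenius_def)
    ultimately show ?thesis using pseudo_frobenius_eqI[OF f] by auto
  qed
  then show "pseudo_frobenius S = {F}" using assms(4) by blast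
qed

text \<open>The gap \<open>g\<close> has to be exempted: \<open>F = g + s\<close> forces
  \<open>s = g\<close>, which is not in \<open>S\<close>.\<close>

lemma pseudo_frobenius_doubleton_iff:
  assumes "submonoid S" "gaps S = - S" "finite (gaps S)" "F \<in> pseudo_frobenius S"
    and F: "F = g + g"
  shows "pseudo_frobenius S = {F, g} \<longleftrightarrow> (\<forall>h\<in>gaps S - {g}. \<exists>s\<in>S. F = h + s)"
proof
  assume PF: "pseudo_frobenius S = {F, g}"
  show "\<forall>h\<in>gaps S - {g}. \<exists>s\<in>S. F = h + s"
  proof
    fix h assume h: "h \<in> gaps S - {g}"
    with assms obtain s where s: "s \<in> S" "h + s \<in> pseudo_frobenius S"
      by (metis DiffD1 gap_add_pseudo_frobenius)
    then consider "h + s = F" | "h + s = g" using PF by blast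
    then show "\<exists>s\<in>S. F = h + s"
    proof cases
      case 1 then show ?thesis using s by auto
    next
      case 2
      \<comment> \<open>Here \<open>h\<close> leads to \<open>g\<close> instead of \<open>F\<close>.
        The nonzero \<open>s\<close> pushes one copy of \<open>g\<close> into \<open>S\<close>, and
        the other copy is \<open>h + s\<close>.\<close>
      then have "s \<noteq> 0" using h by auto
      then have "g + s \<in> S" using PF s(1) by (auto simp: pseudo_frobenius_def)
      moreover have "F = h + (g + s)" using 2 F by (simp add: ac_simps)
      ultimately show ?thesis by blast
    qed
  qed
next
  assume *: "\<forall>h\<in>gaps S - {g}. \<exists>s\<in>S. F = h + s"
  have FS: "F \<notin> S" using assms(2,4) by (auto simp: pseudo_frobenius_def)
  then have gS: "g \<notin> S" using assms(1) F by (auto simp: submonoid_def)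
  have "g + s \<in> S" if s: "s \<in> S" "s \<noteq> 0" for s
  proof (rule ccontr)
    assume "g + s \<notin> S"
    \<comment> \<open>As \<open>s\<close> is nonzero, \<open>g + s\<close> is not the exempted gap.
      Cancelling one \<open>g\<close> from \<open>g + g = g + s + t\<close> then puts
      \<open>g\<close> in \<open>S\<close>.\<close>
    then have "g + s \<in> gaps S - {g}" using assms(2) s(2) by auto
    then obtain t where t: "t \<in> S" "F = g + s + t" using * by blast
    then have "g = s + t" using F by (simp add: add.assoc)
    then show False using gS assms(1) s(1) t(1) by (auto simp: submonoid_def)
  qed
  then have "g \<in> pseudo_frobenius S" using gS assms(2) by (auto simp: pseudo_frobenius_def)
  moreover have "f = F" if f: "f \<in> pseudo_frobenius S" "f \<noteq> g" for f
  proof -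
    obtain s where "s \<in> S" "F = f + s" using * f by (auto simp: pseudo_frobenius_def)
    then show ?thesis using pseudo_frobenius_eqI[OF f(1)] FS by auto
  qed
  ultimately show "pseudo_frobenius S = {F, g}" using assms(4) by blast
qed

text \<open>Almost symmetry says that reflection in \<open>F\<close> preserves the pseudo-Frobenius
  elements other than \<open>F\<close>. A single remaining element is therefore a fixed point, that
  is, half of \<open>F\<close>.\<close>

lemma prec_pseudo_symmetric_iff:
  assumes "submonoid S" and "is_frobenius prec S f"
    and F: "frobenius prec S \<in> pseudo_frobenius S" "frobenius prec S \<notin> S"
  shows "prec_pseudo_symmetric prec S \<longleftrightarrow>
    (\<exists>g. frobenius prec S = g + g \<and> pseudo_frobenius S = {frobenius prec S, g})"
    (is "?L \<longleftrightarrow> (\<exists>g. ?F = g + g \<and> _)")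
proof
  assume L: ?L
  then obtain a b where ab: "pseudo_frobenius S = {a, b}" "a \<noteq> b"
    by (auto simp: prec_pseudo_symmetric_def card_2_iff)
  then obtain g where g: "pseudo_frobenius S = {?F, g}" "g \<noteq> ?F"
    using F(1) by (metis insert_commute insertE singletonD)
  then have "pseudo_frobenius' prec S = {g}" by (auto simp: pseudo_frobenius'_def)
  with L have "rat_vec ?F - rat_vec g = rat_vec g"
    by (auto simp: prec_pseudo_symmetric_def prec_almost_symmetric_def)
  then have "rat_vec ?F = rat_vec (g + g)" by (simp add: rat_vec_add algebra_simps)
  then show "\<exists>g. ?F = g + g \<and> pseudo_frobenius S = {?F, g}"
    using g(1) by (auto simp: rat_vec_inject)
next
  assume "\<exists>g. ?F = g + g \<and> pseudo_frobenius S = {?F, g}"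
  then obtain g where g: "?F = g + g" "pseudo_frobenius S = {?F, g}" by blast
  \<comment> \<open>A nonzero \<open>F\<close> differs from its half, so the set really has two
    elements.\<close>
  have "?F \<noteq> 0" using assms(1) F(2) by (auto simp: submonoid_def)
  then have "g \<noteq> ?F" using g(1) by auto
  then have PF': "pseudo_frobenius' prec S = {g}" and card: "card (pseudo_frobenius S) = 2"
    using g(2) by (auto simp: pseudo_frobenius'_def)
  have "rat_vec ?F - rat_vec g = rat_vec g" unfolding g(1) by (simp add: rat_vec_add)
  then show ?L
    using PF' card assms(2)
    by (auto simp: prec_pseudo_symmetric_def prec_almost_symmetric_def)
qed

theorem theorem3p9:
  fixes S :: "(nat ^ 'd) set" and prec :: "nat ^ 'd \<Rightarrow> nat ^ 'd \<Rightarrow> bool"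
  assumes "C_semigroup S"
    and "rat_cone S \<inter> range rat_vec = range rat_vec"
    and "term_order prec"
  shows "(prec_symmetric prec S \<longleftrightarrow>
           card (gaps S) = card {g \<in> S. g \<le> frobenius prec S}) \<and>
         (prec_pseudo_symmetric prec S \<longleftrightarrow>
           card (gaps S - {h. rat_vec h = (1 / 2) *s rat_vec (frobenius prec S)})
             = card {g \<in> S. g \<le> frobenius prec S} \<and>
           even_vec (frobenius prec S))"
proof -
  let ?F = "frobenius prec S"
  have S: "submonoid S" and fin: "finite (gaps S)" and ne: "gaps S \<noteq> {}"
    using assms(1) affine_semigroup_submonoid by (auto simp: C_semigroup_def MPD_semigroup_def)
  have gaps: "gaps S = - S" using gaps_eq_Compl[OF assms(2)] .
  obtain f where f: "is_frobenius prec S f" using ex_is_frobenius[OF assms(3) fin ne] ..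
  have isF: "is_frobenius prec S ?F" using is_frobenius_frobenius[OF assms(3) f] .
  have PF: "?F \<in> pseudo_frobenius S"
    using is_frobenius_pseudo_frobenius[OF assms(3) gaps isF] .
  have FS: "?F \<notin> S" using isF gaps by (auto simp: is_frobenius_def)
  \<comment> \<open>This is the condition on \<open>H\<close> for counting with all gaps: if
    \<open>h\<close> were in \<open>S\<close>, so would be \<open>F\<close>.\<close>
  have compl: "h \<in> gaps S" if "s \<in> S" "?F = h + s" for h s
    using that FS S gaps by (auto simp: submonoid_def)
  have "prec_symmetric prec S \<longleftrightarrow> pseudo_frobenius S = {?F}"
    using f by (auto simp: prec_symmetric_def)
  also have "\<dots> \<longleftrightarrow> card (gaps S) = card {g \<in> S. g \<le> ?F}"
    by (simp only: pseudo_frobenius_singleton_iff[OF S gaps fin PF]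
        card_complement_eq_iff[OF fin compl])
  finally have 1: "prec_symmetric prec S \<longleftrightarrow> card (gaps S) = card {g \<in> S. g \<le> ?F}" .
  have half: "pseudo_frobenius S = {?F, g} \<longleftrightarrow>
      card (gaps S - {h. rat_vec h = (1 / 2) *s rat_vec ?F}) = card {g \<in> S. g \<le> ?F}"
    if g: "?F = g + g" for g
  proof -
    have "{h. rat_vec h = (1 / 2) *s rat_vec ?F} = {h. rat_vec h = rat_vec g}"
      using g rat_vec_eq_half_iff[of g ?F] by simp
    then have eq: "{h. rat_vec h = (1 / 2) *s rat_vec ?F} = {g}"
      by (simp add: rat_vec_inject)
    have "h \<in> gaps S - {g}" if s: "s \<in> S" "?F = h + s" for h s
    proof -
      have "h \<noteq> g"
      proof
        assume "h = g"
        then have "g \<in> S" using s g by simp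
        then show False using S FS g by (auto simp: submonoid_def)
      qed
      then show ?thesis using compl[OF s] by blast
    qed
    then have "card (gaps S - {g}) = card {g \<in> S. g \<le> ?F}
        \<longleftrightarrow> (\<forall>h\<in>gaps S - {g}. \<exists>s\<in>S. ?F = h + s)"
      using fin by (intro card_complement_eq_iff) auto
    then show ?thesis
      by (simp only: eq pseudo_frobenius_doubleton_iff[OF S gaps fin PF g])
  qed
  show ?thesis
    \<comment> \<open>For even \<open>F\<close>, \<open>even_vec_iff\<close> supplies the
      \<open>g\<close> needed in \<open>half\<close>; otherwise both sides of the second equivalence
      are false.\<close>
    using 1 half prec_pseudo_symmetric_iff[OF S f PF FS] even_vec_iff[of ?F] by blast
qed

end
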